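(* Let $H$ be an infinite-dimensional separable complex Hilbert space and let $\mathcal T=(T_1,\dots,T_n)\in B(H)^n$ be such that $\operatorname{Int}W_e(\mathcal T)\neq\emptyset$. Then $$\operatorname{Int}\overline{W(\mathcal T)}\subset W(\mathcal T).$$
   Context: $B(H)$ is the algebra of bounded linear operators on $H$; the operators $T_j$ are not assumed to commute. $\operatorname{Int}$ denotes interior in $\mathbb C^n$. Joint numerical range: $W(\mathcal T)=\{(\langle T_1x,x\rangle,\dots,\langle T_nx,x\rangle): x\in H,\ \|x\|=1\}$. Joint essential numerical range: $W_e(\mathcal T)$ is the set of all $(\lambda_1,\dots,\lambda_n)\in\mathbb C^n$ for which there exists an orthonormal sequence $(x_k)_{k\ge1}\subset H$ with $\lim_{k\to\infty}\langle T_jx_k,x_k\rangle=\lambda_j$ for $j=1,\dots,n$. *)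

theory Defs
  imports "HOL-Analysis.Analysis"
begin

text \<open>
  A complex inner product space is presented on top of its underlying real inner product space,
  whose inner product is the real part of the complex one. This reuses the library's norm and
  topology: \<open>norm x = sqrt (Re (cinner x x))\<close>, and positive definiteness of \<open>cinner\<close>
  is inherited from \<open>inner\<close>. The complex inner product is linear in its \<^emph>\<open>first\<close> argument.
\<close>

class complex_inner = real_inner +
  fixes scaleC :: "complex \<Rightarrow> 'a \<Rightarrow> 'a" (infixr "*\<^sub>C" 75)
    and cinner :: "'a \<Rightarrow> 'a \<Rightarrow> complex"
  assumes scaleC_add_right: "c *\<^sub>C (x + y) = c *\<^sub>C x + c *\<^sub>C y"
    and scaleC_add_left: "(c + d) *\<^sub>C x = c *\<^sub>C x + d *\<^sub>C x"
    and scaleC_scaleC: "c *\<^sub>C d *\<^sub>C x = (c * d) *\<^sub>C x"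
    and scaleR_scaleC: "r *\<^sub>R x = complex_of_real r *\<^sub>C x"
    and cinner_commute: "cinner x y = cnj (cinner y x)"
    and cinner_add_left: "cinner (x + y) z = cinner x z + cinner y z"
    and cinner_scaleC_left: "cinner (c *\<^sub>C x) y = c * cinner x y"
    and inner_eq_Re_cinner: "inner x y = Re (cinner x y)"

class complex_hilbert_space = complex_inner + complete_space

lemma scaleC_one: "1 *\<^sub>C x = (x :: 'a :: complex_inner)"
  using scaleR_scaleC[of 1 x] by simp

global_interpretation complex_vector: vector_space "scaleC :: complex \<Rightarrow> 'a \<Rightarrow> 'a::complex_inner"
  by unfold_locales
    (simp_all add: scaleC_add_right scaleC_add_left scaleC_scaleC scaleC_one)

definition infinite_cdim :: "'a::complex_inner itself \<Rightarrow> bool" where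
  "infinite_cdim _ \<longleftrightarrow> \<not> (\<exists>B :: 'a set. finite B \<and> complex_vector.span B = UNIV)"

definition bounded_clinear :: "('a::complex_inner \<Rightarrow> 'b::complex_inner) \<Rightarrow> bool" where
  "bounded_clinear T \<longleftrightarrow> bounded_linear T \<and> (\<forall>c x. T (c *\<^sub>C x) = c *\<^sub>C T x)"

definition orthonormal_seq :: "(nat \<Rightarrow> 'a::complex_inner) \<Rightarrow> bool" where
  "orthonormal_seq x \<longleftrightarrow> (\<forall>k l. cinner (x k) (x l) = (if k = l then 1 else 0))"

definition joint_numerical_range ::
    "('n::finite \<Rightarrow> 'a::complex_inner \<Rightarrow> 'a) \<Rightarrow> (complex ^ 'n) set" where
  "joint_numerical_range T = {(\<chi> j. cinner (T j x) x) | x. norm x = 1}"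

definition joint_ess_numerical_range ::
    "('n::finite \<Rightarrow> 'a::complex_inner \<Rightarrow> 'a) \<Rightarrow> (complex ^ 'n) set" where
  "joint_ess_numerical_range T =
     {v. \<exists>x. orthonormal_seq x \<and> (\<forall>j. (\<lambda>k. cinner (T j (x k)) (x k)) \<longlonglongrightarrow> v $ j)}"

end

theory Submission
  imports Defs
begin

text \<open>
  The proof rests on a superposition principle. Call unit vectors decoupled if they are orthogonal
  and all cross terms \<open>\<langle>T\<^sub>j u, v\<rangle>\<close>, \<open>\<langle>T\<^sub>j v, u\<rangle>\<close> vanish. For pairwise decoupled unit vectors \<open>u\<^sub>i\<close>
  and convex weights \<open>t\<^sub>i\<close>, the unit vector \<open>\<Sum> \<surd>t\<^sub>i u\<^sub>i\<close> realises exactly the convex combination, with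
  weights \<open>t\<^sub>i\<close>, of the points realised by the \<open>u\<^sub>i\<close>. Non-convexity of the joint numerical range is
  thus only an obstacle for vectors that cannot be decoupled.

  Essential values can always be realised, approximately, by vectors decoupled from any given finite
  set. Decoupling from finitely many vectors means lying in the common kernel of finitely many
  bounded functionals; these tend to \<open>0\<close> along an orthonormal sequence, so the sequence can be moved
  into the common kernel by a vanishing correction
  (\<open>ess_numerical_range_approx_decoupled\<close>).

  For an interior point \<open>c\<close> of the essential range the approximation becomes exact. Take the vertices
  of a small cross-polytope centred at \<open>c\<close> and inside the essential range, and approximate all of them
  by pairwise decoupled vectors. The centre still lies in the convex hull of the perturbed vertices, so
  the superposition principle attains it
  (\<open>interior_ess_numerical_range_attained_decoupled\<close>).

  Decoupling such a vector from one that realises \<open>w\<close> shows that the numerical range contains the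
  segment from each of its points \<open>w\<close> to each interior essential value. Finally, if \<open>p\<close> is interior to
  the closure of the numerical range, extend the ray from \<open>c\<close> through \<open>p\<close> slightly beyond \<open>p\<close> and pick
  a numerical value \<open>w\<close> near the end point: the line from \<open>w\<close> through \<open>p\<close> then passes so close to \<open>c\<close>
  that it meets the interior of the essential range behind \<open>p\<close>, hence \<open>p\<close> lies on such a segment.
\<close>

section \<open>The complex inner product as a bounded bilinear map\<close>

lemma Im_cinner_eq_inner: "Im (cinner x y) = inner x (\<i> *\<^sub>C y)"
proof -
  have "cinner x (\<i> *\<^sub>C y) = cnj (\<i> * cinner y x)"
    by (subst cinner_commute) (simp add: cinner_scaleC_left)
  also have "\<dots> = - \<i> * cinner x y"
    by (subst (2) cinner_commute) simp
  finally show ?thesis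
    by (simp add: inner_eq_Re_cinner)
qed

lemma norm_scaleC_ii: "norm (\<i> *\<^sub>C y) = norm y"
proof -
  have "inner (\<i> *\<^sub>C y) (\<i> *\<^sub>C y) = Im (cinner (\<i> *\<^sub>C y) y)"
    by (simp add: Im_cinner_eq_inner)
  also have "\<dots> = inner y y"
    by (simp add: cinner_scaleC_left inner_eq_Re_cinner)
  finally show ?thesis
    by (simp add: norm_eq_sqrt_inner)
qed

text \<open>
  The real inner product controls the real part and, after multiplication of one argument by \<open>\<i>\<close>, the
  imaginary part, so Cauchy-Schwarz for the real inner product bounds both, with the crude constant \<open>2\<close>
  for their sum.
\<close>

lemma bounded_bilinear_cinner:
  "bounded_bilinear (cinner :: 'a::complex_inner \<Rightarrow> 'a \<Rightarrow> complex)"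
proof
  fix a a' b b' :: 'a and r :: real
  show "cinner (a + a') b = cinner a b + cinner a' b"
    by (rule cinner_add_left)
  have "cinner a (b + b') = cnj (cinner b a + cinner b' a)"
    by (subst cinner_commute) (simp add: cinner_add_left)
  then show "cinner a (b + b') = cinner a b + cinner a b'"
    by (metis cinner_commute complex_cnj_add)
  show "cinner (r *\<^sub>R a) b = r *\<^sub>R cinner a b"
    by (simp add: scaleR_scaleC cinner_scaleC_left scaleR_conv_of_real)
  have "cinner a (r *\<^sub>R b) = cnj (of_real r * cinner b a)"
    by (subst cinner_commute) (simp add: scaleR_scaleC cinner_scaleC_left)
  then show "cinner a (r *\<^sub>R b) = r *\<^sub>R cinner a b"
    by (metis cinner_commute complex_cnj_mult complex_cnj_complex_of_real scaleR_conv_of_real)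
next
  have "norm (cinner a b) \<le> norm a * norm b * 2" for a b :: 'a
  proof -
    have "norm (cinner a b) \<le> \<bar>inner a b\<bar> + \<bar>inner a (\<i> *\<^sub>C b)\<bar>"
      by (metis cmod_le inner_eq_Re_cinner Im_cinner_eq_inner)
    also have "\<dots> \<le> norm a * norm b + norm a * norm b"
      by (metis add_mono Cauchy_Schwarz_ineq2 norm_scaleC_ii)
    finally show ?thesis by simp
  qed
  then show "\<exists>K. \<forall>a b :: 'a. norm (cinner a b) \<le> norm a * norm b * K" by blast
qed

lemmas bounded_linear_cinner_left =
  bounded_bilinear.bounded_linear_left[OF bounded_bilinear_cinner]
lemmas bounded_linear_cinner_right =
  bounded_bilinear.bounded_linear_right[OF bounded_bilinear_cinner]

lemma cinner_self: "cinner x x = complex_of_real ((norm x)\<^sup>2)"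
proof (rule complex_eqI)
  show "Re (cinner x x) = Re (complex_of_real ((norm x)\<^sup>2))"
    by (simp add: inner_eq_Re_cinner[symmetric] power2_norm_eq_inner)
  show "Im (cinner x x) = Im (complex_of_real ((norm x)\<^sup>2))"
    using arg_cong[OF cinner_commute[of x x], of Im] by simp
qed

section \<open>Vectors decoupled with respect to a tuple of operators\<close>

definition numerical_point :: "('n::finite \<Rightarrow> 'a::complex_inner \<Rightarrow> 'a) \<Rightarrow> 'a \<Rightarrow> complex ^ 'n" where
  "numerical_point T x = (\<chi> j. cinner (T j x) x)"

definition decoupled :: "('n \<Rightarrow> 'a::complex_inner \<Rightarrow> 'a) \<Rightarrow> 'a \<Rightarrow> 'a \<Rightarrow> bool" where
  "decoupled T u v \<longleftrightarrow>
     cinner u v = 0 \<and> (\<forall>j. cinner (T j u) v = 0 \<and> cinner (T j v) u = 0)"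

lemma joint_numerical_range_eq: "joint_numerical_range T = numerical_point T ` {x. norm x = 1}"
  by (auto simp: joint_numerical_range_def numerical_point_def)

lemma decoupled_sym: "decoupled T u v \<Longrightarrow> decoupled T v u"
  unfolding decoupled_def by (metis cinner_commute complex_cnj_zero)

lemma decoupled_sum_left:
  assumes T: "\<And>j. bounded_linear (T j)" and "\<And>i. i \<in> I \<Longrightarrow> decoupled T (u i) v"
  shows "decoupled T (\<Sum>i\<in>I. s i *\<^sub>R u i) v"
  using assms(2)
  by (simp add: decoupled_def linear_sum[OF bounded_linear.linear[OF T]]
      linear_scale[OF bounded_linear.linear[OF T]]
      bounded_bilinear.sum_left[OF bounded_bilinear_cinner]
      bounded_bilinear.sum_right[OF bounded_bilinear_cinner]
      bounded_bilinear.scaleR_left[OF bounded_bilinear_cinner]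
      bounded_bilinear.scaleR_right[OF bounded_bilinear_cinner])

text \<open>
  Square roots as coefficients turn quadratic forms into convex combinations: once the off-diagonal terms
  vanish, each diagonal term carries the factor \<open>\<surd>t\<^sub>i \<cdot> \<surd>t\<^sub>i = t\<^sub>i\<close>. The case where \<open>A\<close> is the identity
  computes the norm.
\<close>

lemma cinner_sum_diagonal:
  assumes "finite I" "bounded_linear A" and t: "\<And>i. i \<in> I \<Longrightarrow> t i \<ge> 0"
    and off: "\<And>i k. i \<in> I \<Longrightarrow> k \<in> I \<Longrightarrow> i \<noteq> k \<Longrightarrow> cinner (A (u i)) (u k) = 0"
  defines "y \<equiv> \<Sum>i\<in>I. sqrt (t i) *\<^sub>R u i"
  shows "cinner (A y) y = (\<Sum>i\<in>I. t i *\<^sub>R cinner (A (u i)) (u i))"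
proof -
  have A: "A y = (\<Sum>i\<in>I. sqrt (t i) *\<^sub>R A (u i))"
    by (simp add: y_def linear_sum[OF bounded_linear.linear[OF assms(2)]]
      linear_scale[OF bounded_linear.linear[OF assms(2)]])
  have "cinner (A y) y =
      (\<Sum>i\<in>I. \<Sum>k\<in>I. sqrt (t i) *\<^sub>R sqrt (t k) *\<^sub>R cinner (A (u i)) (u k))"
    unfolding A unfolding y_def
    by (subst sum.swap) (simp add: bounded_bilinear.sum_left[OF bounded_bilinear_cinner]
      bounded_bilinear.sum_right[OF bounded_bilinear_cinner]
      bounded_bilinear.scaleR_left[OF bounded_bilinear_cinner]
      bounded_bilinear.scaleR_right[OF bounded_bilinear_cinner] scaleR_sum_right mult_ac)
  also have "\<dots> = (\<Sum>i\<in>I. \<Sum>k\<in>I. if k = i then t i *\<^sub>R cinner (A (u i)) (u i) else 0)"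
  proof (intro sum.cong refl)
    fix i k assume "i \<in> I" "k \<in> I"
    then show "sqrt (t i) *\<^sub>R sqrt (t k) *\<^sub>R cinner (A (u i)) (u k) =
        (if k = i then t i *\<^sub>R cinner (A (u i)) (u i) else 0)"
      using t[of i] off[of i k] by simp
  qed
  also have "\<dots> = (\<Sum>i\<in>I. t i *\<^sub>R cinner (A (u i)) (u i))"
    using \<open>finite I\<close> by simp
  finally show ?thesis .
qed

text \<open>
  The superposition principle: decoupled vectors behave as if the joint numerical range were convex.
\<close>

lemma decoupled_convex_combination:
  assumes "finite I" and T: "\<And>j. bounded_linear (T j)"
    and t: "\<And>i. i \<in> I \<Longrightarrow> t i \<ge> 0" "sum t I = 1"
    and u: "\<And>i. i \<in> I \<Longrightarrow> norm (u i) = 1"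
    and dec: "\<And>i k. i \<in> I \<Longrightarrow> k \<in> I \<Longrightarrow> i \<noteq> k \<Longrightarrow> decoupled T (u i) (u k)"
  defines "y \<equiv> \<Sum>i\<in>I. sqrt (t i) *\<^sub>R u i"
  shows "norm y = 1" and "numerical_point T y = (\<Sum>i\<in>I. t i *\<^sub>R numerical_point T (u i))"
proof -
  have "cinner y y = (\<Sum>i\<in>I. t i *\<^sub>R cinner (u i) (u i))"
    unfolding y_def
    using cinner_sum_diagonal[OF \<open>finite I\<close> bounded_linear_ident t(1), where u = u] dec
    by (simp add: decoupled_def)
  also have "\<dots> = (\<Sum>i\<in>I. complex_of_real (t i))"
    by (intro sum.cong refl) (simp add: cinner_self u scaleR_conv_of_real)
  also have "\<dots> = 1"
    using t(2) by (metis of_real_1 of_real_sum)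
  finally have "complex_of_real ((norm y)\<^sup>2) = complex_of_real 1"
    by (simp add: cinner_self)
  then have "(norm y)\<^sup>2 = 1" by (metis of_real_eq_iff)
  then show "norm y = 1"
    by (simp add: power2_eq_1_iff) (use norm_ge_zero[of y] in linarith)
  show "numerical_point T y = (\<Sum>i\<in>I. t i *\<^sub>R numerical_point T (u i))"
    unfolding y_def vec_eq_iff numerical_point_def
    using cinner_sum_diagonal[OF \<open>finite I\<close> T t(1), where u = u] dec
    by (simp add: decoupled_def)
qed

section \<open>Approximating essential numerical values by decoupled unit vectors\<close>

text \<open>
  Bessel's inequality, stated for a functional instead of its representing vector. Evaluating \<open>\<phi>\<close> at
  \<open>v = \<Sum> \<phi> (x\<^sub>k) x\<^sub>k\<close> gives \<open>\<phi> v = \<parallel>v\<parallel>\<^sup>2 = \<Sum> \<phi> (x\<^sub>k)\<^sup>2\<close>, so boundedness of \<open>\<phi>\<close> bounds these partial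
  sums. In this form it applies directly to conditions such as \<open>\<langle>T\<^sub>j u, v\<rangle> = 0\<close> on \<open>u\<close>.
\<close>

lemma bounded_linear_orthonormal_tendsto_0:
  fixes \<phi> :: "'a::complex_inner \<Rightarrow> real"
  assumes x: "orthonormal_seq x" and "bounded_linear \<phi>"
  shows "(\<lambda>k. \<phi> (x k)) \<longlonglongrightarrow> 0"
proof -
  interpret bounded_linear \<phi> by fact
  obtain B where B: "B > 0" "\<And>v. norm (\<phi> v) \<le> norm v * B"
    using pos_bounded by blast
  have inner_x: "inner (x k) (x l) = (if k = l then 1 else 0)" for k l
    using x by (simp add: orthonormal_seq_def inner_eq_Re_cinner)
  have bound: "(\<Sum>k<K. (\<phi> (x k))\<^sup>2) \<le> B\<^sup>2" for K
  proof -
    define S where "S = (\<Sum>k<K. (\<phi> (x k))\<^sup>2)"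
    define v where "v = (\<Sum>k<K. \<phi> (x k) *\<^sub>R x k)"
    have "\<phi> v = S"
      by (simp add: v_def S_def sum scaleR power2_eq_square)
    moreover have "inner v v = S"
      by (simp add: v_def S_def inner_sum_left inner_sum_right inner_x power2_eq_square
        if_distrib[of "(*) _"] cong: if_cong)
    moreover have "S \<ge> 0" by (simp add: S_def sum_nonneg)
    ultimately have "S \<le> sqrt S * B"
      using B(2)[of v] by (simp add: norm_eq_sqrt_inner)
    then have "sqrt S * sqrt S \<le> sqrt S * B" using \<open>S \<ge> 0\<close> by simp
    then have "sqrt S \<le> B"
      using \<open>S \<ge> 0\<close> B(1) mult_left_le_imp_le[of "sqrt S" "sqrt S" B] by (cases "S = 0") auto
    then have "(sqrt S)\<^sup>2 \<le> B\<^sup>2" using \<open>S \<ge> 0\<close> by (intro power_mono) auto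
    then show ?thesis using \<open>S \<ge> 0\<close> by (simp add: S_def)
  qed
  have "summable (\<lambda>k. (\<phi> (x k))\<^sup>2)"
    by (rule summableI_nonneg_bounded[OF _ bound]) simp
  then have "(\<lambda>k. (\<phi> (x k))\<^sup>2) \<longlonglongrightarrow> 0"
    by (rule summable_LIMSEQ_zero)
  then have "(\<lambda>k. sqrt ((\<phi> (x k))\<^sup>2)) \<longlonglongrightarrow> 0"
    using tendsto_real_sqrt by fastforce
  then show ?thesis
    by (simp add: tendsto_rabs_zero_iff)
qed

text \<open>
  The functionals are treated one at a time. If \<open>\<phi>\<close> does not already vanish on the common kernel of the
  earlier ones, that kernel contains a vector \<open>e\<close> with \<open>\<phi> e \<noteq> 0\<close>; subtracting the right multiple of \<open>e\<close> kills
  \<open>\<phi>\<close> without disturbing the earlier functionals, and the multiple tends to \<open>0\<close> because \<open>\<phi> (z\<^sub>k)\<close> does.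
\<close>

lemma correct_into_common_kernel:
  fixes x :: "nat \<Rightarrow> 'a::real_normed_vector" and \<Phi> :: "('a \<Rightarrow> real) set"
  assumes "finite \<Phi>" and "\<And>\<phi>. \<phi> \<in> \<Phi> \<Longrightarrow> bounded_linear \<phi>"
    and "\<And>\<phi>. \<phi> \<in> \<Phi> \<Longrightarrow> (\<lambda>k. \<phi> (x k)) \<longlonglongrightarrow> 0"
  shows "\<exists>z. (\<forall>\<phi>\<in>\<Phi>. \<forall>k. \<phi> (z k) = 0) \<and> (\<lambda>k. z k - x k) \<longlonglongrightarrow> 0"
  using assms
proof (induction \<Phi> rule: finite_induct)
  case empty
  show ?case by (intro exI[of _ x]) simp
next
  case (insert \<phi> \<Phi>)
  have "\<exists>z. (\<forall>\<psi>\<in>\<Phi>. \<forall>k. \<psi> (z k) = 0) \<and> (\<lambda>k. z k - x k) \<longlonglongrightarrow> 0"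
    by (rule insert.IH) (use insert.prems in auto)
  then obtain z where z: "\<And>\<psi> k. \<psi> \<in> \<Phi> \<Longrightarrow> \<psi> (z k) = 0" and zx: "(\<lambda>k. z k - x k) \<longlonglongrightarrow> 0"
    by blast
  interpret \<phi>: bounded_linear \<phi> using insert.prems by simp
  show ?case
  proof (cases "\<exists>e. (\<forall>\<psi>\<in>\<Phi>. \<psi> e = 0) \<and> \<phi> e \<noteq> 0")
    case False
    then have "\<forall>k. \<phi> (z k) = 0" using z by blast
    then show ?thesis using z zx by auto
  next
    case True
    then obtain e where e: "\<And>\<psi>. \<psi> \<in> \<Phi> \<Longrightarrow> \<psi> e = 0" "\<phi> e \<noteq> 0" by blast
    define z' where "z' k = z k - (\<phi> (z k) / \<phi> e) *\<^sub>R e" for k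
    have "(\<lambda>k. \<phi> (z k - x k) + \<phi> (x k)) \<longlonglongrightarrow> \<phi> 0 + 0"
      using insert.prems(2)[of \<phi>] by (intro tendsto_add \<phi>.tendsto zx) auto
    then have "(\<lambda>k. \<phi> (z k)) \<longlonglongrightarrow> 0" by (simp add: \<phi>.diff \<phi>.zero)
    then have "(\<lambda>k. (z k - x k) - (\<phi> (z k) / \<phi> e) *\<^sub>R e) \<longlonglongrightarrow> 0 - (0 / \<phi> e) *\<^sub>R e"
      using e(2) by (intro tendsto_intros zx) auto
    then have "(\<lambda>k. z' k - x k) \<longlonglongrightarrow> 0"
      by (simp add: z'_def algebra_simps)
    moreover have "\<psi> (z' k) = 0" if "\<psi> \<in> insert \<phi> \<Phi>" for \<psi> k
    proof -
      interpret \<psi>: bounded_linear \<psi> using insert.prems that by blast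
      show ?thesis
        using that
      proof
        assume "\<psi> = \<phi>"
        then show ?thesis using e(2) by (simp add: z'_def \<phi>.diff \<phi>.scaleR)
      next
        assume "\<psi> \<in> \<Phi>"
        then show ?thesis using e(1)[of \<psi>] z[of \<psi> k] by (simp add: z'_def \<psi>.diff \<psi>.scaleR)
      qed
    qed
    ultimately show ?thesis by blast
  qed
qed

text \<open>
  An orthonormal sequence realising \<open>\<mu>\<close> is moved into the common kernel of the functionals expressing
  decoupling from \<open>F\<close> and renormalised. Both changes vanish in the limit, hence do not affect the limit of the
  quadratic forms.
\<close>

lemma ess_numerical_range_approx_decoupled:
  fixes T :: "'n::finite \<Rightarrow> 'a::complex_inner \<Rightarrow> 'a"
  assumes T: "\<And>j. bounded_linear (T j)" and "\<mu> \<in> joint_ess_numerical_range T"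
    and "finite F" "\<epsilon> > 0"
  shows "\<exists>u. norm u = 1 \<and> (\<forall>v\<in>F. decoupled T u v) \<and> dist (numerical_point T u) \<mu> < \<epsilon>"
proof -
  obtain x where x: "orthonormal_seq x"
    and lim: "\<And>j. (\<lambda>k. cinner (T j (x k)) (x k)) \<longlonglongrightarrow> \<mu> $ j"
    using assms(2) by (auto simp: joint_ess_numerical_range_def)
  have norm_x: "norm (x k) = 1" for k
    using x by (simp add: orthonormal_seq_def norm_eq_sqrt_inner inner_eq_Re_cinner)
  define G where "G = (\<Union>v\<in>F. insert (\<lambda>u. cinner u v)
      (range (\<lambda>j u. cinner (T j u) v) \<union> range (\<lambda>j u. cinner (T j v) u)))"
  have "finite G" using \<open>finite F\<close> by (auto simp: G_def)
  have "bounded_linear g" if "g \<in> G" for g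
    using that T bounded_linear_compose[OF bounded_linear_cinner_left]
    by (auto simp: G_def bounded_linear_cinner_left bounded_linear_cinner_right)
  \<comment> \<open>Some maps in \<open>G\<close> are conjugate-linear in \<open>u\<close>; real and imaginary parts make all of them
    real functionals.\<close>
  define \<Phi> where "\<Phi> = (\<lambda>g u. Re (g u)) ` G \<union> (\<lambda>g u. Im (g u)) ` G"
  have \<Phi>: "bounded_linear \<phi>" if "\<phi> \<in> \<Phi>" for \<phi>
    using that \<open>\<And>g. g \<in> G \<Longrightarrow> bounded_linear g\<close>
    by (auto simp: \<Phi>_def intro: bounded_linear_compose[OF bounded_linear_Re]
        bounded_linear_compose[OF bounded_linear_Im])
  have "finite \<Phi>" using \<open>finite G\<close> by (simp add: \<Phi>_def)
  then obtain z where z: "\<And>\<phi> k. \<phi> \<in> \<Phi> \<Longrightarrow> \<phi> (z k) = 0" and zx: "(\<lambda>k. z k - x k) \<longlonglongrightarrow> 0"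
    using correct_into_common_kernel[of \<Phi> x] \<Phi> bounded_linear_orthonormal_tendsto_0[OF x]
    by blast
  define u where "u k = sgn (z k)" for k
  have "(\<lambda>k. norm (z k) - norm (x k)) \<longlonglongrightarrow> 0"
    by (rule Lim_null_comparison[OF _ tendsto_norm_zero[OF zx]])
      (simp add: norm_triangle_ineq3)
  then have nz: "(\<lambda>k. norm (z k) - 1) \<longlonglongrightarrow> 0" by (simp add: norm_x)
  then have "(\<lambda>k. norm (z k)) \<longlonglongrightarrow> 1" by (simp add: LIM_zero_cancel)
  then have "\<forall>\<^sub>F k in sequentially. norm (z k) > 0"
    by (rule order_tendstoD) simp
  then have nonzero: "\<forall>\<^sub>F k in sequentially. z k \<noteq> 0" by simp
  have "(\<lambda>k. u k - z k) \<longlonglongrightarrow> 0"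
  proof (rule Lim_null_comparison[OF _ tendsto_rabs_zero[OF nz]])
    show "\<forall>\<^sub>F k in sequentially. norm (u k - z k) \<le> \<bar>norm (z k) - 1\<bar>"
      using nonzero
    proof eventually_elim
      case (elim k)
      have "u k - z k = (1 - norm (z k)) *\<^sub>R sgn (z k)"
        using elim by (simp add: u_def sgn_div_norm algebra_simps)
      then show ?case using elim by (simp add: norm_sgn)
    qed
  qed
  then have "(\<lambda>k. (u k - z k) + (z k - x k)) \<longlonglongrightarrow> 0 + 0" by (intro tendsto_add zx)
  then have ux: "(\<lambda>k. u k - x k) \<longlonglongrightarrow> 0" by simp
  have Bx: "Bfun x sequentially"
    by (rule BfunI[of _ 1]) (simp add: norm_x)
  have Bu: "Bfun u sequentially"
    by (rule BfunI[of _ 1]) (simp add: u_def norm_sgn)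
  have "(\<lambda>k. numerical_point T (u k)) \<longlonglongrightarrow> \<mu>"
  proof (rule vec_tendstoI)
    fix j
    interpret P: bounded_bilinear "\<lambda>a b. cinner (T j a) b"
      using bounded_bilinear.comp[OF bounded_bilinear_cinner T bounded_linear_ident] .
    have Z: "Zfun (\<lambda>k. u k - x k) sequentially"
      using ux by (simp add: tendsto_Zfun_iff)
    have "Zfun (\<lambda>k. cinner (T j (u k - x k)) (u k) + cinner (T j (x k)) (u k - x k)) sequentially"
      by (intro Zfun_add P.Zfun_prod_Bfun P.Bfun_prod_Zfun Z Bu Bx)
    then have "(\<lambda>k. cinner (T j (u k)) (u k) - cinner (T j (x k)) (x k)) \<longlonglongrightarrow> 0"
      by (simp add: tendsto_Zfun_iff P.diff_left P.diff_right)
    from tendsto_add[OF this lim[of j]]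
    show "(\<lambda>k. numerical_point T (u k) $ j) \<longlonglongrightarrow> \<mu> $ j"
      by (simp add: numerical_point_def)
  qed
  then have "\<forall>\<^sub>F k in sequentially. dist (numerical_point T (u k)) \<mu> < \<epsilon>"
    using \<open>\<epsilon> > 0\<close> by (rule tendstoD)
  from eventually_happens[OF eventually_conj[OF this nonzero]]
  obtain k where k: "dist (numerical_point T (u k)) \<mu> < \<epsilon>" "z k \<noteq> 0" by auto
  have ker: "g (u k) = 0" if "g \<in> G" for g
  proof -
    interpret g: bounded_linear g using that by fact
    have "g (z k) = 0"
      using z[of "\<lambda>u. Re (g u)" k] z[of "\<lambda>u. Im (g u)" k] that
      by (auto simp: \<Phi>_def complex_eq_iff)
    then show ?thesis by (simp add: u_def sgn_div_norm g.scaleR)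
  qed
  have "decoupled T (u k) v" if "v \<in> F" for v
    using that ker[of "\<lambda>u. cinner u v"] ker[of "\<lambda>u. cinner (T j u) v" for j]
      ker[of "\<lambda>u. cinner (T j v) u" for j]
    unfolding decoupled_def G_def by blast
  then show ?thesis
    using k by (intro exI[of _ "u k"]) (simp add: u_def norm_sgn)
qed

lemma ess_numerical_range_approx_decoupled_family:
  fixes T :: "'n::finite \<Rightarrow> 'a::complex_inner \<Rightarrow> 'a"
  assumes T: "\<And>j. bounded_linear (T j)" and "finite C" "C \<subseteq> joint_ess_numerical_range T"
    and "finite F" "\<epsilon> > 0"
  shows "\<exists>u. \<forall>c\<in>C. norm (u c) = 1 \<and> dist (numerical_point T (u c)) c < \<epsilon> \<and>
           (\<forall>v\<in>F. decoupled T (u c) v) \<and> (\<forall>d\<in>C. c \<noteq> d \<longrightarrow> decoupled T (u c) (u d))"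
  using assms(2,3)
proof (induction C rule: finite_induct)
  case empty
  show ?case by simp
next
  case (insert a C)
  then obtain u where u: "\<forall>c\<in>C. norm (u c) = 1 \<and> dist (numerical_point T (u c)) c < \<epsilon> \<and>
      (\<forall>v\<in>F. decoupled T (u c) v) \<and> (\<forall>d\<in>C. c \<noteq> d \<longrightarrow> decoupled T (u c) (u d))"
    by auto
  have "\<exists>w. norm w = 1 \<and> (\<forall>v\<in>F \<union> u ` C. decoupled T w v) \<and> dist (numerical_point T w) a < \<epsilon>"
    by (rule ess_numerical_range_approx_decoupled) (use T assms(4,5) insert in auto)
  then obtain w where w: "norm w = 1" "\<forall>v \<in> F \<union> u ` C. decoupled T w v"
      "dist (numerical_point T w) a < \<epsilon>"
    by blast
  show ?case
    using u w \<open>a \<notin> C\<close> by (intro exI[of _ "u(a := w)"]) (auto intro: decoupled_sym)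
qed

section \<open>Interior essential values are attained\<close>

text \<open>
  A hyperplane separating \<open>c\<close> from the perturbed vertices has a normal \<open>d\<close>, some coordinate of which has
  absolute value at least \<open>\<parallel>d\<parallel> / n\<close>, where \<open>n\<close> is the dimension. The vertex opposite to that coordinate lies
  at least \<open>\<rho> \<parallel>d\<parallel> / n\<close> below \<open>c\<close> in direction \<open>d\<close>, and a displacement by at most \<open>\<rho> / n\<close> cannot carry it
  strictly above \<open>c\<close>.
\<close>

lemma center_in_hull_perturbed_cross_polytope:
  fixes c :: "'b::euclidean_space" and a :: "'b \<Rightarrow> 'b"
  assumes "\<rho> > 0"
  defines "C \<equiv> (\<lambda>b. c + \<rho> *\<^sub>R b) ` Basis \<union> (\<lambda>b. c - \<rho> *\<^sub>R b) ` Basis"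
  assumes a: "\<And>v. v \<in> C \<Longrightarrow> dist (a v) v \<le> \<rho> / DIM('b)"
  shows "c \<in> convex hull (a ` C)"
proof (rule ccontr)
  assume "c \<notin> convex hull (a ` C)"
  moreover have "finite C" by (simp add: C_def)
  then have "closed (convex hull (a ` C))"
    by (simp add: compact_imp_closed finite_imp_compact compact_convex_hull)
  ultimately obtain d \<beta> where d: "inner d c < \<beta>" "\<forall>x\<in>convex hull (a ` C). \<beta> < inner d x"
    using separating_hyperplane_closed_point[OF convex_convex_hull] by blast
  have sep: "inner d c < inner d (a v)" if "v \<in> C" for v
    using d that hull_inc[of "a v" "a ` C" convex] by force
  \<comment> \<open>If separation held, every coordinate of \<open>d\<close> would be too small for its norm.\<close>
  have "\<bar>inner d b\<bar> < norm d / DIM('b)" if b: "b \<in> Basis" for b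
  proof -
    define v where "v = (if inner d b \<ge> 0 then c - \<rho> *\<^sub>R b else c + \<rho> *\<^sub>R b)"
    have "v \<in> C" using b by (auto simp: v_def C_def)
    have v: "inner d v = inner d c - \<rho> * \<bar>inner d b\<bar>"
      by (auto simp: v_def inner_diff_right inner_add_right)
    have "inner d (a v) - inner d v \<le> norm d * norm (a v - v)"
      using norm_cauchy_schwarz[of d "a v - v"] by (simp add: inner_diff_right)
    also have "\<dots> \<le> norm d * (\<rho> / DIM('b))"
      using a[OF \<open>v \<in> C\<close>] by (intro mult_left_mono) (auto simp: dist_norm)
    finally have "\<rho> * \<bar>inner d b\<bar> < \<rho> * (norm d / DIM('b))"
      using sep[OF \<open>v \<in> C\<close>] v by (simp add: mult_ac)
    then show ?thesis using \<open>\<rho> > 0\<close> by (simp only: mult_less_cancel_left_pos)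
  qed
  then have "(\<Sum>b\<in>(Basis::'b set). \<bar>inner d b\<bar>) < (\<Sum>b\<in>(Basis::'b set). norm d / DIM('b))"
    by (intro sum_strict_mono) auto
  then show False using norm_le_l1[of d] by simp
qed

text \<open>
  Besides giving exact values, the approximating vectors are chosen decoupled from \<open>F\<close>, a property that passes
  to their combinations; this is what allows a later superposition with a prescribed vector.
\<close>

lemma interior_ess_numerical_range_attained_decoupled:
  fixes T :: "'n::finite \<Rightarrow> 'a::complex_inner \<Rightarrow> 'a"
  assumes T: "\<And>j. bounded_linear (T j)" and "c \<in> interior (joint_ess_numerical_range T)"
    and "finite F"
  shows "\<exists>y. norm y = 1 \<and> (\<forall>v\<in>F. decoupled T y v) \<and> numerical_point T y = c"
proof -
  obtain \<rho> where \<rho>: "\<rho> > 0" "cball c \<rho> \<subseteq> joint_ess_numerical_range T"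
    using assms(2) by (meson mem_interior_cball)
  define C where "C = (\<lambda>b. c + \<rho> *\<^sub>R b) ` Basis \<union> (\<lambda>b. c - \<rho> *\<^sub>R b) ` Basis"
  have "finite C" by (simp add: C_def)
  have "C \<subseteq> cball c \<rho>" using \<rho>(1) by (auto simp: C_def dist_norm)
  with \<rho>(2) have "C \<subseteq> joint_ess_numerical_range T" by blast
  moreover have "\<rho> / DIM(complex ^ 'n) > 0" using \<rho>(1) by (intro divide_pos_pos) simp_all
  ultimately have "\<exists>u. \<forall>c\<in>C. norm (u c) = 1 \<and>
      dist (numerical_point T (u c)) c < \<rho> / DIM(complex ^ 'n) \<and>
      (\<forall>v\<in>F. decoupled T (u c) v) \<and> (\<forall>d\<in>C. c \<noteq> d \<longrightarrow> decoupled T (u c) (u d))"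
    by (intro ess_numerical_range_approx_decoupled_family T \<open>finite C\<close> \<open>finite F\<close>)
  then obtain u where u: "\<And>v. v \<in> C \<Longrightarrow> norm (u v) = 1"
    "\<And>v. v \<in> C \<Longrightarrow> dist (numerical_point T (u v)) v < \<rho> / DIM(complex ^ 'n)"
    "\<And>v w. v \<in> C \<Longrightarrow> w \<in> F \<Longrightarrow> decoupled T (u v) w"
    "\<And>v w. v \<in> C \<Longrightarrow> w \<in> C \<Longrightarrow> v \<noteq> w \<Longrightarrow> decoupled T (u v) (u w)"
    by blast
  have "c \<in> convex hull ((\<lambda>v. numerical_point T (u v)) ` C)"
    unfolding C_def
    by (rule center_in_hull_perturbed_cross_polytope[OF \<rho>(1)])
      (use u(2) in \<open>auto simp: C_def intro: less_imp_le\<close>)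
  \<comment> \<open>A union of singletons, so that the weights are indexed by vertices: distinct vertices may be
    realised at the same point.\<close>
  also have "(\<lambda>v. numerical_point T (u v)) ` C = (\<Union>v\<in>C. {numerical_point T (u v)})" by blast
  finally have "\<exists>t. (\<forall>v\<in>C. t v \<ge> 0) \<and> sum t C = 1 \<and> c = (\<Sum>v\<in>C. t v *\<^sub>R numerical_point T (u v))"
    by (subst (asm) convex_hull_finite_union[OF \<open>finite C\<close>]) auto
  then obtain t where t: "\<And>v. v \<in> C \<Longrightarrow> t v \<ge> 0" "sum t C = 1"
    and c: "c = (\<Sum>v\<in>C. t v *\<^sub>R numerical_point T (u v))"
    by blast
  note comb = decoupled_convex_combination[where T = T and u = u, OF \<open>finite C\<close> T t u(1) u(4)]
  let ?y = "\<Sum>v\<in>C. sqrt (t v) *\<^sub>R u v"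
  have "\<forall>w\<in>F. decoupled T ?y w"
    by (intro ballI decoupled_sum_left T u(3))
  then show ?thesis
    using comb(1) comb(2)[folded c] by blast
qed

section \<open>From the closure of the numerical range to the numerical range\<close>

lemma segment_to_interior_ess_numerical_range:
  fixes T :: "'n::finite \<Rightarrow> 'a::complex_inner \<Rightarrow> 'a"
  assumes T: "\<And>j. bounded_linear (T j)" and "w \<in> joint_numerical_range T"
    and "c \<in> interior (joint_ess_numerical_range T)" and t: "0 \<le> t" "t \<le> 1"
  shows "(1 - t) *\<^sub>R w + t *\<^sub>R c \<in> joint_numerical_range T"
proof -
  obtain x where x: "norm x = 1" "w = numerical_point T x"
    using assms(2) by (auto simp: joint_numerical_range_eq)
  obtain y where y: "norm y = 1" "decoupled T y x" "numerical_point T y = c"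
    using interior_ess_numerical_range_attained_decoupled[where T = T and F = "{x}", OF T assms(3)]
    by auto
  let ?t = "\<lambda>i. if i then t else 1 - t" and ?u = "\<lambda>i. if i then y else x"
  have "decoupled T (?u i) (?u k)" if "i \<noteq> k" for i k
    using that y(2) by (auto intro: decoupled_sym)
  then have "norm (\<Sum>i\<in>UNIV. sqrt (?t i) *\<^sub>R ?u i) = 1"
      "numerical_point T (\<Sum>i\<in>UNIV. sqrt (?t i) *\<^sub>R ?u i) =
        (\<Sum>i\<in>UNIV. ?t i *\<^sub>R numerical_point T (?u i))"
    using x y t by (intro decoupled_convex_combination[where T = T, OF finite[of UNIV] T]; simp add: UNIV_bool)+
  moreover have "(\<Sum>i\<in>UNIV. ?t i *\<^sub>R numerical_point T (?u i)) = (1 - t) *\<^sub>R w + t *\<^sub>R c"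
    using x y by (simp add: UNIV_bool)
  ultimately show ?thesis
    unfolding joint_numerical_range_eq
    by (intro image_eqI[of _ _ "\<Sum>i\<in>UNIV. sqrt (?t i) *\<^sub>R ?u i"]) simp_all
qed

text \<open>
  With \<open>q = p + s (p - c)\<close>, a point \<open>w\<close> of the numerical range within \<open>s \<rho>\<close> of \<open>q\<close> and \<open>c' = c + (q - w) / s\<close>,
  the identity \<open>w + s c' = q + s c = (1 + s) p\<close> places \<open>p\<close> on the segment from \<open>w\<close> to \<open>c'\<close>.
\<close>

theorem theorem5p11:
  fixes T :: "'n::finite \<Rightarrow> 'a::complex_hilbert_space \<Rightarrow> 'a"
  assumes "infinite_cdim TYPE('a)"
    and "separable_space (euclidean :: 'a topology)"
    and "\<And>j. bounded_clinear (T j)"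
    and "interior (joint_ess_numerical_range T) \<noteq> {}"
  shows "interior (closure (joint_numerical_range T)) \<subseteq> joint_numerical_range T"
proof
  fix p assume "p \<in> interior (closure (joint_numerical_range T))"
  then obtain r where r: "r > 0" "ball p r \<subseteq> closure (joint_numerical_range T)"
    by (meson mem_interior)
  have T: "bounded_linear (T j)" for j
    using assms(3) by (simp add: bounded_clinear_def)
  obtain c where "c \<in> interior (joint_ess_numerical_range T)" using assms(4) by blast
  then obtain \<rho> where \<rho>: "\<rho> > 0" "ball c \<rho> \<subseteq> interior (joint_ess_numerical_range T)"
    by (meson open_contains_ball open_interior)
  \<comment> \<open>The summand \<open>1\<close> covers the case \<open>p = c\<close>.\<close>
  define s where "s = r / 2 / (norm (p - c) + 1)"
  have pos: "norm (p - c) + 1 > 0" by (simp add: add_nonneg_pos)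
  with r(1) have s: "s > 0" by (simp only: s_def divide_pos_pos zero_less_numeral)
  have "s * norm (p - c) < s * (norm (p - c) + 1)" using s by simp
  also have "\<dots> = r / 2"
    by (rule iffD1[OF nonzero_eq_divide_eq[OF less_imp_neq[OF pos, symmetric]] s_def])
  finally have "s * norm (p - c) < r" using r(1) by linarith
  define q where "q = p + s *\<^sub>R (p - c)"
  have "q \<in> closure (joint_numerical_range T)"
    using \<open>s * norm (p - c) < r\<close> s r(2) by (auto simp: q_def dist_norm)
  then obtain w where w: "w \<in> joint_numerical_range T" "dist w q < s * \<rho>"
    using mult_pos_pos[OF s \<rho>(1)] closure_approachable by blast
  define c' where "c' = c + (1 / s) *\<^sub>R (q - w)"
  have "norm ((1 / s) *\<^sub>R (q - w)) < \<rho>"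
    using w(2) s unfolding norm_scaleR by (simp add: dist_norm norm_minus_commute field_simps)
  then have c': "c' \<in> interior (joint_ess_numerical_range T)"
    using \<rho>(2) by (auto simp: c'_def dist_norm)
  define t where "t = s / (1 + s)"
  have t: "0 \<le> t" "t \<le> 1" "1 - t = 1 / (1 + s)"
    using s by (auto simp: t_def field_simps)
  have "(1 - t) *\<^sub>R w + t *\<^sub>R c' = (1 / (1 + s)) *\<^sub>R (w + s *\<^sub>R c')"
    unfolding t(3) by (simp add: t_def scaleR_right_distrib)
  also have "w + s *\<^sub>R c' = (1 + s) *\<^sub>R p"
    using s by (simp add: c'_def q_def algebra_simps)
  finally have "(1 - t) *\<^sub>R w + t *\<^sub>R c' = p"
    using s by simp
  with segment_to_interior_ess_numerical_range[where T = T, OF T w(1) c' t(1,2)]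
  show "p \<in> joint_numerical_range T" by simp
qed

end
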